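(* Let $G$ be a $q$-SSG with $r$ random vertices and $n$ MAX vertices. Then every run of the Generic Strategy Improvement Algorithm (GSIA) on $G$ performs at most $nq^{r}$ iterations. Here GSIA is: start from an arbitrary positional MAX strategy $\sigma$; while $(\sigma,\tau(\sigma))$ is not a pair of optimal strategies of $G$, choose any subset $A$ of the arcs of $G$, find any positional MAX strategy $\sigma'$ with $\sigma' \succ_{G[A,\sigma]} \sigma$, and set $\sigma\leftarrow\sigma'$; finally return $(\sigma,\tau(\sigma))$, $\tau(\sigma)$ being a positional best response to $\sigma$.
   Context: A simple stochastic game (SSG) $G$ is a finite directed graph whose vertex set is partitioned into MAX vertices, MIN vertices, random vertices and a nonempty set of sinks; every non-sink vertex has at least one outgoing arc, every sink has exactly one outgoing arc, a self-loop; each random vertex $x$ carries a rational probability distribution $p_x$ on its out-neighbourhood, positive on every out-neighbour; each sink $s$ has rational value $\mathrm{Val}(s)\in[0,1]$. A $q$-SSG is an SSG with exactly two sinks, of values $0$ and $1$, such that for every random vertex $x$ there is an integer $1\le q_x\le q$ with $p_x(x')=\ell_{x,x'}/q_x$ for natural numbers $\ell_{x,x'}$. A positional MAX (resp. MIN) strategy assigns to each MAX (resp. MIN) vertex one of its out-neighbours. Under $\sigma,\tau$ from start $x_0$, the random play moves from MAX vertex $x$ to $\sigma(x)$, from MIN vertex $x$ to $\tau(x)$, from random vertex $x$ to an out-neighbour drawn by $p_x$ independently, and stays at a sink once reached; its value is $\mathrm{Val}(s)$ if it reaches sink $s$, else $0$, and $v^G_{\sigma,\tau}(x_0)$ is its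 expectation. A best response to $\sigma$ is a positional MIN strategy $\tau$ with $v_{\sigma,\tau}\le v_{\sigma,\tau'}$ pointwise for all MIN strategies $\tau'$ (one exists); $v^G_\sigma:=v^G_{\sigma,\tau}$ for such $\tau$. A pair $(\sigma,\tau)$ is optimal if $\sigma$ maximises $v^G_\sigma$ pointwise over positional MAX strategies and $\tau$ is a best response to $\sigma$. Vectors are compared pointwise; $v>v'$ means $v\ge v'$ and $v\ne v'$. In a game $H$, $\sigma'\succ_H\sigma$ means $v^H_{\sigma'}>v^H_\sigma$ and, for every MAX vertex $x$ with $v^H_{\sigma'}(x)=v^H_\sigma(x)$, $\sigma'(x)=\sigma(x)$. Transformed game: $G[A,\sigma]$ is obtained from a copy of $G$ by replacing each arc $e=(x,y)\in A$ by an arc $(x,s_e)$ to a new sink $s_e$ of value $v^G_\sigma(y)$ (for random $x$, $p_x(s_e)=p_x(y)$); $y$ is kept. Strategies of $G$ and $G[A,\sigma]$ are identified, and value vectors of $G[A,\sigma]$ are compared only on vertices of $G$. *)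

theory Defs
  imports Complex_Main
begin

record 'v ssg =
  verts :: "'v set"
  maxv  :: "'v set"
  minv  :: "'v set"
  randv :: "'v set"
  sinks :: "'v set"
  arcs  :: "('v \<times> 'v) set"
  prob  :: "'v \<Rightarrow> 'v \<Rightarrow> real"
  sval  :: "'v \<Rightarrow> real"

definition outn :: "('v, 'z) ssg_scheme \<Rightarrow> 'v \<Rightarrow> 'v set" where
  "outn G x = {y. (x, y) \<in> arcs G}"

definition is_ssg :: "('v, 'z) ssg_scheme \<Rightarrow> bool" where
  "is_ssg G \<longleftrightarrow>
     finite (verts G) \<and>
     maxv G \<union> minv G \<union> randv G \<union> sinks G = verts G \<and>
     maxv G \<inter> minv G = {} \<and> maxv G \<inter> randv G = {} \<and> maxv G \<inter> sinks G = {} \<and>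
     minv G \<inter> randv G = {} \<and> minv G \<inter> sinks G = {} \<and> randv G \<inter> sinks G = {} \<and>
     sinks G \<noteq> {} \<and>
     arcs G \<subseteq> verts G \<times> verts G \<and>
     (\<forall>x \<in> verts G - sinks G. outn G x \<noteq> {}) \<and>
     (\<forall>s \<in> sinks G. outn G s = {s}) \<and>
     (\<forall>x \<in> randv G. (\<forall>y \<in> outn G x. prob G x y > 0 \<and> prob G x y \<in> \<rat>) \<and>
                       (\<Sum>y \<in> outn G x. prob G x y) = 1) \<and>
     (\<forall>s \<in> sinks G. sval G s \<in> \<rat> \<and> 0 \<le> sval G s \<and> sval G s \<le> 1)"

definition is_qssg :: "nat \<Rightarrow> ('v, 'z) ssg_scheme \<Rightarrow> bool" where
  "is_qssg q G \<longleftrightarrow> is_ssg G \<and> card (sinks G) = 2 \<and> sval G ` sinks G = {0, 1} \<and>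
     (\<forall>x \<in> randv G. \<exists>qx::nat. 1 \<le> qx \<and> qx \<le> q \<and>
        (\<forall>y \<in> outn G x. \<exists>l::nat. prob G x y = real l / real qx))"

definition max_strat :: "('v, 'z) ssg_scheme \<Rightarrow> ('v \<Rightarrow> 'v) \<Rightarrow> bool" where
  "max_strat G \<sigma> \<longleftrightarrow> (\<forall>x \<in> maxv G. (x, \<sigma> x) \<in> arcs G)"

definition min_strat :: "('v, 'z) ssg_scheme \<Rightarrow> ('v \<Rightarrow> 'v) \<Rightarrow> bool" where
  "min_strat G \<tau> \<longleftrightarrow> (\<forall>x \<in> minv G. (x, \<tau> x) \<in> arcs G)"

text \<open>nsteps G sigma tau n x: expected payoff Val(s) of the play from x if it has
  reached sink s within n steps, and 0 otherwise.\<close>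
fun nsteps :: "('v, 'z) ssg_scheme \<Rightarrow> ('v \<Rightarrow> 'v) \<Rightarrow> ('v \<Rightarrow> 'v) \<Rightarrow> nat \<Rightarrow> 'v \<Rightarrow> real" where
  "nsteps G \<sigma> \<tau> 0 x = (if x \<in> sinks G then sval G x else 0)"
| "nsteps G \<sigma> \<tau> (Suc n) x =
     (if x \<in> sinks G then sval G x
      else if x \<in> maxv G then nsteps G \<sigma> \<tau> n (\<sigma> x)
      else if x \<in> minv G then nsteps G \<sigma> \<tau> n (\<tau> x)
      else (\<Sum>y \<in> outn G x. prob G x y * nsteps G \<sigma> \<tau> n y))"

text \<open>Value of the play: expectation of Val(reached sink), 0 if no sink is reached;
  the limit (supremum) of the nondecreasing n-step values.\<close>
definition val :: "('v, 'z) ssg_scheme \<Rightarrow> ('v \<Rightarrow> 'v) \<Rightarrow> ('v \<Rightarrow> 'v) \<Rightarrow> 'v \<Rightarrow> real" where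
  "val G \<sigma> \<tau> x = (SUP n. nsteps G \<sigma> \<tau> n x)"

definition best_resp :: "('v, 'z) ssg_scheme \<Rightarrow> ('v \<Rightarrow> 'v) \<Rightarrow> ('v \<Rightarrow> 'v) \<Rightarrow> bool" where
  "best_resp G \<sigma> \<tau> \<longleftrightarrow> min_strat G \<tau> \<and>
     (\<forall>\<tau>'. min_strat G \<tau>' \<longrightarrow> (\<forall>x \<in> verts G. val G \<sigma> \<tau> x \<le> val G \<sigma> \<tau>' x))"

definition br :: "('v, 'z) ssg_scheme \<Rightarrow> ('v \<Rightarrow> 'v) \<Rightarrow> ('v \<Rightarrow> 'v)" where
  "br G \<sigma> = (SOME \<tau>. best_resp G \<sigma> \<tau>)"

definition val_s :: "('v, 'z) ssg_scheme \<Rightarrow> ('v \<Rightarrow> 'v) \<Rightarrow> 'v \<Rightarrow> real" where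
  "val_s G \<sigma> = val G \<sigma> (br G \<sigma>)"

definition optimal :: "('v, 'z) ssg_scheme \<Rightarrow> ('v \<Rightarrow> 'v) \<Rightarrow> ('v \<Rightarrow> 'v) \<Rightarrow> bool" where
  "optimal G \<sigma> \<tau> \<longleftrightarrow> max_strat G \<sigma> \<and>
     (\<forall>\<sigma>'. max_strat G \<sigma>' \<longrightarrow> (\<forall>x \<in> verts G. val_s G \<sigma>' x \<le> val_s G \<sigma> x)) \<and>
     best_resp G \<sigma> \<tau>"

definition redir :: "'v ssg \<Rightarrow> ('v \<times> 'v) set \<Rightarrow> ('v \<times> 'v) set" where
  "redir G A = {e \<in> A. e \<in> arcs G \<and> fst e \<notin> sinks G}"

definition transform :: "'v ssg \<Rightarrow> ('v \<times> 'v) set \<Rightarrow> ('v \<Rightarrow> 'v) \<Rightarrow> ('v + 'v \<times> 'v) ssg" where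
  "transform G A \<sigma> =
    \<lparr> verts = Inl ` verts G \<union> Inr ` redir G A,
      maxv = Inl ` maxv G, minv = Inl ` minv G, randv = Inl ` randv G,
      sinks = Inl ` sinks G \<union> Inr ` redir G A,
      arcs = {(Inl x, Inl y) | x y. (x, y) \<in> arcs G \<and> (x, y) \<notin> redir G A}
           \<union> {(Inl x, Inr (x, y)) | x y. (x, y) \<in> redir G A}
           \<union> {(Inr e, Inr e) | e. e \<in> redir G A},
      prob = (\<lambda>u w. case (u, w) of
                (Inl x, Inl y) \<Rightarrow> prob G x y
              | (Inl x, Inr e) \<Rightarrow> (if fst e = x then prob G x (snd e) else 0)
              | _ \<Rightarrow> 0),
      sval = (\<lambda>u. case u of Inl s \<Rightarrow> sval G s | Inr e \<Rightarrow> val_s G \<sigma> (snd e)) \<rparr>"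

definition lift :: "'v ssg \<Rightarrow> ('v \<times> 'v) set \<Rightarrow> ('v \<Rightarrow> 'v) \<Rightarrow> ('v + 'v \<times> 'v) \<Rightarrow> ('v + 'v \<times> 'v)" where
  "lift G A \<sigma> u = (case u of
      Inl x \<Rightarrow> (if (x, \<sigma> x) \<in> redir G A then Inr (x, \<sigma> x) else Inl (\<sigma> x))
    | Inr e \<Rightarrow> Inr e)"

definition improves :: "'v ssg \<Rightarrow> ('v \<times> 'v) set \<Rightarrow> ('v \<Rightarrow> 'v) \<Rightarrow> ('v \<Rightarrow> 'v) \<Rightarrow> bool" where
  "improves G A \<sigma>' \<sigma> \<longleftrightarrow>
    (let H = transform G A \<sigma>;
         w' = val_s H (lift G A \<sigma>');
         w = val_s H (lift G A \<sigma>)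
     in (\<forall>x \<in> verts G. w (Inl x) \<le> w' (Inl x)) \<and>
        (\<exists>x \<in> verts G. w (Inl x) \<noteq> w' (Inl x)) \<and>
        (\<forall>x \<in> maxv G. w' (Inl x) = w (Inl x) \<longrightarrow> \<sigma>' x = \<sigma> x))"

definition gsia_run :: "'v ssg \<Rightarrow> (nat \<Rightarrow> 'v \<Rightarrow> 'v) \<Rightarrow> nat \<Rightarrow> bool" where
  "gsia_run G \<sigma>s k \<longleftrightarrow> max_strat G (\<sigma>s 0) \<and>
     (\<forall>i < k. \<not> optimal G (\<sigma>s i) (br G (\<sigma>s i)) \<and>
        (\<exists>A. A \<subseteq> arcs G \<and> max_strat G (\<sigma>s (Suc i)) \<and> improves G A (\<sigma>s (Suc i)) (\<sigma>s i)))"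

end

theory Submission
  imports Defs "HOL-Library.FuncSet"
begin

text \<open>Let \<open>\<sigma>'\<close> improve \<open>\<sigma>\<close> in \<open>G[A, \<sigma>]\<close>. The values of \<open>\<sigma>\<close> in \<open>G\<close> and in \<open>G[A, \<sigma>]\<close> agree, and a
  maximum principle shows that the value of \<open>\<sigma>'\<close> in \<open>G\<close> is at least its value in \<open>G[A, \<sigma>]\<close>.
  Hence values never decrease. Moreover some MAX vertex \<open>x\<close> satisfies \<open>v\<^sub>\<sigma>(\<sigma>'(x)) > v\<^sub>\<sigma>(x)\<close>, since
  otherwise \<open>v\<^sub>\<sigma>\<close> would be superharmonic for \<open>\<sigma>'\<close> in \<open>G[A, \<sigma>]\<close>. All values of \<open>v\<^sub>\<sigma>\<close> have a common
  denominator \<open>D \<le> q\<^sup>r\<close>, so \<open>v\<^bsub>\<sigma>'\<^esub>(x) = v\<^bsub>\<sigma>'\<^esub>(\<sigma>'(x)) \<ge> v\<^sub>\<sigma>(\<sigma>'(x)) \<ge> v\<^sub>\<sigma>(x) + q\<^bsup>-r\<^esup>\<close>, and the sum of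
  the values of the \<open>n\<close> MAX vertices, which lies between \<open>0\<close> and \<open>n\<close>, grows by at least \<open>q\<^bsup>-r\<^esup>\<close>
  in each iteration.

  The denominator is obtained without determinants: if \<open>\<ell>(x, y) / q\<^sub>x\<close> are the transition
  probabilities, \<open>D\<close> counts the functions choosing a successor for every non-sink vertex whose
  graph is a forest rooted at the sinks, with weight \<open>\<Prod>\<^sub>x \<ell>(x, f x)\<close>; without the forest
  condition the weighted count would be \<open>\<Prod>\<^sub>x q\<^sub>x\<close>.\<close>

section \<open>Weighted rooted forests\<close>

text \<open>Inductive, hence only finite paths count: a vertex whose \<open>f\<close>-path cycles
  outside \<open>S\<close> leads nowhere. The path ends at its first vertex in
  \<open>S\<close>.\<close>

inductive leads :: "'v set \<Rightarrow> ('v \<Rightarrow> 'v) \<Rightarrow> 'v \<Rightarrow> 'v \<Rightarrow> bool" for S f where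
  stop: "s \<in> S \<Longrightarrow> leads S f s s"
| step: "x \<notin> S \<Longrightarrow> leads S f (f x) s \<Longrightarrow> leads S f x s"

lemma leads_in: "leads S f a s \<Longrightarrow> s \<in> S"
  by (induction rule: leads.induct) auto

lemma leads_unique: "leads S f a s \<Longrightarrow> leads S f a t \<Longrightarrow> s = t"
proof (induction rule: leads.induct)
  case (stop s)
  from stop(2,1) show ?case by cases auto
next
  case (step x s)
  from step.prems step.hyps(1) have "leads S f (f x) t" by cases auto
  then show ?case by (rule step.IH)
qed

text \<open>Adding a vertex \<open>x\<close> to the stopping set tells whether a path meets \<open>x\<close>: it does iff it then
  stops at \<open>x\<close>.\<close>
lemma leads_insert_other:
  assumes "leads (insert x S) f a s" "s \<noteq> x"
  shows "leads S f a s"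
  using assms by (induction rule: leads.induct) (auto intro: leads.intros)

lemma leads_insert_through:
  assumes "leads (insert x S) f a x" "x \<notin> S" "leads S f x t"
  shows "leads S f a t"
proof -
  have "leads S f a t" if "leads (insert x S) f a b" "b = x" for b
    using that assms(2,3) by (induction rule: leads.induct) (auto intro: leads.intros)
  then show ?thesis using assms(1) by blast
qed

lemma leads_insert_ex:
  assumes "leads S f a s"
  shows "\<exists>t. leads (insert x S) f a t"
  using assms
proof (induction rule: leads.induct)
  case (stop s)
  then show ?case by (auto intro: leads.stop)
next
  case (step a s)
  then show ?case by (cases "a = x") (auto intro: leads.intros)
qed

text \<open>Once \<open>x\<close> is a stopping point, no path consults the value of
  \<open>f\<close> there.\<close>

lemma leads_fun_upd:
  "leads (insert x S) (f(x := z)) a s \<longleftrightarrow> leads (insert x S) f a s"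
proof
  show "leads (insert x S) f a s" if "leads (insert x S) (f(x := z)) a s"
    using that by (induction rule: leads.induct) (auto intro: leads.intros)
  show "leads (insert x S) (f(x := z)) a s" if "leads (insert x S) f a s"
    using that
  proof (induction rule: leads.induct)
    case (step y s)
    then show ?case using leads.step[of y "insert x S" "f(x := z)" s]
      by (simp add: fun_upd_other del: fun_upd_apply)
  qed (rule leads.stop)
qed

text \<open>A path that returns to its start is periodic and never ends in \<open>S\<close>.\<close>

lemma leads_avoids_start:
  assumes "leads S f x s" "x \<notin> S"
  shows "leads (insert x S) f (f x) s"
proof -
  have fx: "leads S f (f x) s"
    using assms by cases auto
  then obtain t where t: "leads (insert x S) f (f x) t"
    using leads_insert_ex by metis
  have "t \<noteq> x"
  proof
    assume "t = x"
    \<comment> \<open>If \<open>f x\<close> led back to \<open>x\<close>, the vertices whose path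
      meets \<open>x\<close> would be closed under \<open>f\<close> and disjoint from
      \<open>S\<close>, so none of them could lead to \<open>S\<close>; but \<open>x\<close> is one
      of them.\<close>
    define C where "C = {a. leads (insert x S) f a x}"
    have closed: "f a \<in> C \<and> a \<notin> S" if "a \<in> C" for a
    proof (cases "a = x")
      case True
      then show ?thesis using t \<open>t = x\<close> assms(2) by (simp add: C_def)
    next
      case False
      from that have "leads (insert x S) f a x" by (simp add: C_def)
      then show ?thesis using False by cases (auto simp: C_def)
    qed
    have "a \<notin> C" if "leads S f a s" for a
      using that by (induction rule: leads.induct) (use closed in auto)
    then show False
      using assms(1) by (auto simp: C_def intro: leads.stop)
  qed
  then show ?thesis
    using t leads_insert_other[OF t] leads_unique[OF fx] by metis
qed

text \<open>A Markov chain absorbed in \<open>S\<close>, with integer weights instead of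
  probabilities: the row sum of \<open>x\<close> plays the role of the denominator at
  \<open>x\<close>.\<close>

locale weighted_chain =
  fixes V S :: "'v set" and l :: "'v \<Rightarrow> 'v \<Rightarrow> nat"
  assumes finV: "finite V" and SV: "S \<subseteq> V"
begin

definition weight :: "('v \<Rightarrow> 'v) \<Rightarrow> nat" where
  "weight f = (\<Prod>x \<in> V - S. l x (f x))"

text \<open>Functions are extensional, so that each forest is counted once and there are finitely
  many.\<close>

definition forests :: "('v \<Rightarrow> 'v) set" where
  "forests = {f \<in> (V - S) \<rightarrow>\<^sub>E V. \<forall>a \<in> V. \<exists>s. leads S f a s}"

definition root :: "('v \<Rightarrow> 'v) \<Rightarrow> 'v \<Rightarrow> 'v" where
  "root f a = (THE s. leads S f a s)"

lemma root_eq: "leads S f a s \<Longrightarrow> root f a = s"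
  unfolding root_def by (rule the_equality) (auto intro: leads_unique)

lemma leads_root: "f \<in> forests \<Longrightarrow> a \<in> V \<Longrightarrow> leads S f a (root f a)"
  unfolding forests_def by (auto dest: root_eq)

lemma finite_forests: "finite forests"
  by (rule finite_subset[of _ "(V - S) \<rightarrow>\<^sub>E V"]) (auto simp: forests_def finV intro: finite_PiE)

text \<open>Cross-multiplied because \<open>l x (f x)\<close> may be 0.\<close>

lemma weight_swap:
  assumes "x \<in> V - S"
  shows "weight (f(x := y)) * l x (f x) = weight f * l x y"
proof -
  have *: "weight g = l x (g x) * (\<Prod>z \<in> V - S - {x}. l z (g z))" for g
    unfolding weight_def using finV assms by (subst prod.remove[of _ x]) auto
  have "(\<Prod>z \<in> V - S - {x}. l z ((f(x := y)) z)) = (\<Prod>z \<in> V - S - {x}. l z (f z))"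
    by (rule prod.cong) auto
  then show ?thesis unfolding * by simp
qed

text \<open>The path from \<open>y\<close> avoids \<open>x\<close>, so the new arc closes no cycle;
  paths that met \<open>x\<close> now continue along the path from \<open>y\<close> to
  \<open>s\<close>.\<close>

lemma forests_redirect:
  assumes f: "f \<in> forests" and x: "x \<in> V - S" and y: "y \<in> V"
    and avoid: "leads (insert x S) f y s" "s \<noteq> x"
  shows "f(x := y) \<in> forests"
proof -
  have "f(x := y) \<in> (V - S) \<rightarrow>\<^sub>E V"
    using f x y by (auto simp: forests_def PiE_iff extensional_def)
  moreover have "\<exists>t. leads S (f(x := y)) a t" if a: "a \<in> V" for a
  proof -
    have "leads S (f(x := y)) y s"
      using avoid by (auto intro: leads_insert_other[of x] simp: leads_fun_upd)
    then have sx: "leads S (f(x := y)) x s"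
      using x leads.step[of x S "f(x := y)" s] by auto
    obtain t where "leads (insert x S) f a t"
      using leads_insert_ex leads_root[OF f a] by metis
    then have t: "leads (insert x S) (f(x := y)) a t"
      by (simp add: leads_fun_upd)
    show ?thesis
    proof (cases "t = x")
      case True
      then show ?thesis using t sx x leads_insert_through by fastforce
    next
      case False
      then show ?thesis using t leads_insert_other by metis
    qed
  qed
  ultimately show ?thesis by (auto simp: forests_def)
qed

text \<open>Up to the total weight of all forests, this is the expectation of \<open>u\<close> at
  the root of \<open>a\<close> in a random forest drawn proportionally to \<open>weight\<close>, as
  in the Markov chain tree theorem.\<close>

definition root_sum :: "('v \<Rightarrow> real) \<Rightarrow> 'v \<Rightarrow> real" where
  "root_sum u a = (\<Sum>f \<in> forests. real (weight f) * u (root f a))"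

text \<open>The involution behind the harmonicity: unless the path from \<open>y\<close> in the forest \<open>f\<close> meets
  \<open>x\<close>, exchange the arc \<open>x \<rightarrow> f x\<close> with the spare arc \<open>x \<rightarrow> y\<close>.\<close>
lemma root_sum_harmonic:
  assumes x: "x \<in> V - S"
  shows "real (\<Sum>y \<in> V. l x y) * root_sum u x = (\<Sum>y \<in> V. real (l x y) * root_sum u y)"
proof -
  \<comment> \<open>The pairs in \<open>thru\<close> are those where the arc from \<open>x\<close>
    to \<open>y\<close> would close a cycle; they are the fixed points of
    \<open>\<Phi>\<close>.\<close>
  define thru where "thru = (\<lambda>(f, y). leads (insert x S) f y x)"
  define \<Phi> where "\<Phi> = (\<lambda>p. if thru p then p else ((fst p)(x := snd p), fst p x))"
  have split: "thru (f, y) \<or> leads (insert x S) f y (root f y) \<and> root f y \<noteq> x"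
    if fy: "f \<in> forests" "y \<in> V" for f y
  proof (cases "thru (f, y)")
    case False
    obtain t where t: "leads (insert x S) f y t"
      using leads_insert_ex leads_root[OF fy] by metis
    with False have "t \<noteq> x" by (auto simp: thru_def)
    with t have "root f y = t" using leads_insert_other root_eq by metis
    with t \<open>t \<noteq> x\<close> show ?thesis by simp
  qed simp
  have fx: "f x \<in> V" if "f \<in> forests" for f
    using that x by (auto simp: forests_def)
  have avoid: "leads (insert x S) f (f x) (root f x) \<and> root f x \<noteq> x" if "f \<in> forests" for f
    using leads_avoids_start[OF leads_root[OF that, of x]] leads_in[OF leads_root[OF that, of x]] x
    by auto
  have maps: "\<Phi> p \<in> forests \<times> V" if "p \<in> forests \<times> V" for p
    using that split forests_redirect[OF _ x] fx by (cases p) (force simp: \<Phi>_def)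
  have invol: "\<Phi> (\<Phi> p) = p" if mem: "p \<in> forests \<times> V" for p
  proof (cases "thru p")
    case False
    obtain f y where p: "p = (f, y)" "f \<in> forests" "y \<in> V" using mem by auto
    have "\<not> thru (f(x := y), f x)"
      using avoid[OF p(2)] leads_unique by (fastforce simp: thru_def leads_fun_upd)
    then show ?thesis using False p by (simp add: \<Phi>_def)
  qed (simp add: \<Phi>_def)
  \<comment> \<open>On fixed points \<open>y\<close> lies above \<open>x\<close> and shares its
    root; on swapped pairs the new spare vertex is \<open>f x\<close>, which still leads to the old
    root of \<open>x\<close>.\<close>
  have roots: "root (fst (\<Phi> p)) (snd (\<Phi> p)) = root (fst p) x" if "p \<in> forests \<times> V" for p
  proof -
    obtain f y where p: "p = (f, y)" "f \<in> forests" "y \<in> V" using \<open>p \<in> forests \<times> V\<close> by auto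
    show ?thesis
    proof (cases "thru p")
      case True
      then have "leads S f y (root f x)"
        using leads_insert_through[of x S f y] leads_root[OF p(2)] x p(1) by (auto simp: thru_def)
      then show ?thesis using True p by (simp add: \<Phi>_def root_eq)
    next
      case False
      have "leads S (f(x := y)) (f x) (root f x)"
        using avoid[OF p(2)] leads_insert_other leads_fun_upd by metis
      then show ?thesis using False p by (simp add: \<Phi>_def root_eq)
    qed
  qed
  have weights: "weight (fst (\<Phi> p)) * l x (snd (\<Phi> p)) = weight (fst p) * l x (snd p)" for p
    using weight_swap[OF x] by (simp add: \<Phi>_def)
  define W where "W = (\<lambda>p. real (weight (fst p) * l x (snd p)))"
  have W: "W (\<Phi> p) = W p" for p
    by (simp only: W_def weights)
  \<comment> \<open>Both sides become sums over pairs of a forest and a spare vertex with the same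
    weight \<open>W\<close>; they differ only in evaluating \<open>u\<close> at the root of
    \<open>x\<close> or of \<open>y\<close>, which \<open>\<Phi>\<close> exchanges.\<close>
  have "real (\<Sum>y \<in> V. l x y) * root_sum u x = (\<Sum>p \<in> forests \<times> V. W p * u (root (fst p) x))"
    unfolding root_sum_def of_nat_sum sum_product W_def
    by (subst sum.swap) (simp add: sum.cartesian_product case_prod_beta algebra_simps)
  also have "\<dots> = (\<Sum>p \<in> forests \<times> V. W p * u (root (fst p) (snd p)))"
    by (rule sum.reindex_bij_witness[of _ \<Phi> \<Phi>]) (auto simp: maps invol W roots simp del: mem_Sigma_iff)
  also have "\<dots> = (\<Sum>y \<in> V. real (l x y) * root_sum u y)"
    unfolding root_sum_def sum_distrib_left W_def
    by (subst sum.swap) (simp add: sum.cartesian_product case_prod_beta algebra_simps)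
  finally show ?thesis .
qed

lemma sum_weight_forests_le: "(\<Sum>f \<in> forests. weight f) \<le> (\<Prod>x \<in> V - S. \<Sum>y \<in> V. l x y)"
proof -
  have "(\<Sum>f \<in> forests. weight f) \<le> (\<Sum>f \<in> (V - S) \<rightarrow>\<^sub>E V. weight f)"
    by (rule sum_mono2) (auto simp: forests_def finV intro: finite_PiE)
  also have "\<dots> = (\<Prod>x \<in> V - S. \<Sum>y \<in> V. l x y)"
    unfolding weight_def using finV by (subst prod_sum_PiE) auto
  finally show ?thesis .
qed

text \<open>Maximum principle: the maximum of \<open>d\<close> spreads along arcs of positive
  weight, and the path in \<open>g\<close> carries it to a sink, where \<open>d\<close> is
  0.\<close>

lemma harmonic_zero:
  fixes d :: "'v \<Rightarrow> real"
  assumes g: "g \<in> forests" "weight g > 0"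
    and harm: "\<And>x. x \<in> V - S \<Longrightarrow> real (\<Sum>y \<in> V. l x y) * d x = (\<Sum>y \<in> V. real (l x y) * d y)"
    and sink: "\<And>s. s \<in> S \<Longrightarrow> d s = 0"
    and a: "a \<in> V"
  shows "d a \<le> 0"
proof -
  define m where "m = Max (d ` V)"
  have le: "d y \<le> m" if "y \<in> V" for y
    using that finV by (simp add: m_def)
  have "m \<in> d ` V"
    unfolding m_def using finV a by (intro Max_in) auto
  then obtain b where b: "b \<in> V" "d b = m" by auto
  have gV: "g x \<in> V" "l x (g x) > 0" if "x \<in> V - S" for x
    using g that finV by (auto simp: forests_def weight_def)
  have "m \<le> 0" if "leads S g b s" "b \<in> V" "d b = m" for b s
    using that
  proof (induction rule: leads.induct)
    case (stop s)
    then show ?case using sink by simp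
  next
    case (step x s)
    then have x: "x \<in> V - S" by simp
    have "(\<Sum>y \<in> V. real (l x y) * (m - d y)) = 0"
      using harm[OF x] step.prems by (simp add: right_diff_distrib sum_subtractf sum_distrib_right)
    then have "real (l x (g x)) * (m - d (g x)) = 0"
      using gV[OF x] finV le by (subst (asm) sum_nonneg_eq_0_iff) auto
    then show ?case using gV[OF x] step.IH by simp
  qed
  then have "m \<le> 0" using leads_root[OF g(1)] b by blast
  then show ?thesis using le[OF a] by simp
qed

text \<open>With \<open>D\<close> the total forest weight, \<open>D * u\<close> and
  \<open>root_sum u\<close> are both harmonic and agree on \<open>S\<close>, hence coincide; the
  latter is an integer combination of sink values.\<close>

lemma common_denominator:
  fixes u :: "'v \<Rightarrow> real"
  assumes g: "g \<in> forests" "weight g > 0"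
    and harm: "\<And>x. x \<in> V - S \<Longrightarrow> real (\<Sum>y \<in> V. l x y) * u x = (\<Sum>y \<in> V. real (l x y) * u y)"
    and sink: "\<And>s. s \<in> S \<Longrightarrow> u s \<in> \<int>"
  obtains D :: nat where "D > 0" "D \<le> (\<Prod>x \<in> V - S. \<Sum>y \<in> V. l x y)"
    "\<And>x. x \<in> V \<Longrightarrow> real D * u x \<in> \<int>"
proof
  define D where "D = (\<Sum>f \<in> forests. weight f)"
  show "D \<le> (\<Prod>x \<in> V - S. \<Sum>y \<in> V. l x y)"
    unfolding D_def by (rule sum_weight_forests_le)
  show "D > 0"
    unfolding D_def using g finite_forests
    by (metis (no_types, lifting) gr0I sum_eq_0_iff)
  have root_sink: "root_sum u s = real D * u s" if "s \<in> S" for s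
    using that by (simp add: root_sum_def D_def sum_distrib_right root_eq[OF leads.stop])
  have eq: "real D * u a = root_sum u a" if "a \<in> V" for a
  proof (rule antisym)
    have "real D * u a - root_sum u a \<le> 0"
      by (rule harmonic_zero[OF g _ _ that, of "\<lambda>a. real D * u a - root_sum u a"])
        (use harm root_sum_harmonic root_sink in
          \<open>simp_all add: right_diff_distrib sum_subtractf mult.left_commute[of _ "real D"]
             flip: sum_distrib_left\<close>)
    then show "real D * u a \<le> root_sum u a" by simp
    have "root_sum u a - real D * u a \<le> 0"
      by (rule harmonic_zero[OF g _ _ that, of "\<lambda>a. root_sum u a - real D * u a"])
        (use harm root_sum_harmonic root_sink in
          \<open>simp_all add: right_diff_distrib sum_subtractf mult.left_commute[of _ "real D"]
             flip: sum_distrib_left\<close>)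
    then show "root_sum u a \<le> real D * u a" by simp
  qed
  show "real D * u x \<in> \<int>" if "x \<in> V" for x
    unfolding eq[OF that] root_sum_def
    using leads_in[OF leads_root[OF _ that]] sink by (intro Ints_sum Ints_mult) auto
qed

end

section \<open>Values under fixed strategies\<close>

text \<open>The equality case for weighted means; it makes the extremal sets in the maximum
  principles for games closed.\<close>

lemma convex_sum_eq_bound:
  fixes w f :: "'a \<Rightarrow> real"
  assumes "finite N" "\<And>y. y \<in> N \<Longrightarrow> w y > 0" "sum w N = 1" "\<And>y. y \<in> N \<Longrightarrow> f y \<le> c"
    and "c \<le> (\<Sum>y \<in> N. w y * f y)" and "y \<in> N"
  shows "f y = c"
proof -
  have "(\<Sum>y \<in> N. w y * (c - f y)) = c - (\<Sum>y \<in> N. w y * f y)"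
    using assms(3) by (simp add: right_diff_distrib sum_subtractf flip: sum_distrib_right)
  also have "\<dots> \<le> 0" using assms(5) by simp
  finally have "(\<Sum>y \<in> N. w y * (c - f y)) = 0"
    using assms by (intro antisym sum_nonneg mult_nonneg_nonneg) (auto intro: less_imp_le)
  then have "w y * (c - f y) = 0"
    using assms by (subst (asm) sum_nonneg_eq_0_iff) (auto intro!: mult_nonneg_nonneg intro: less_imp_le)
  then show ?thesis using assms(2)[OF assms(6)] by simp
qed

text \<open>Together with \<open>kern\<close>, this treats a MAX or MIN move as a random move of
  probability 1, so that \<open>avg\<close> is the one-step operator at all non-sinks.\<close>

definition succs :: "('v, 'z) ssg_scheme \<Rightarrow> ('v \<Rightarrow> 'v) \<Rightarrow> ('v \<Rightarrow> 'v) \<Rightarrow> 'v \<Rightarrow> 'v set" where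
  "succs K \<sigma> \<tau> x = (if x \<in> maxv K then {\<sigma> x} else if x \<in> minv K then {\<tau> x} else outn K x)"

definition kern :: "('v, 'z) ssg_scheme \<Rightarrow> 'v \<Rightarrow> 'v \<Rightarrow> real" where
  "kern K x y = (if x \<in> maxv K \<union> minv K then 1 else prob K x y)"

definition avg :: "('v, 'z) ssg_scheme \<Rightarrow> ('v \<Rightarrow> 'v) \<Rightarrow> ('v \<Rightarrow> 'v) \<Rightarrow> ('v \<Rightarrow> real) \<Rightarrow> 'v \<Rightarrow> real" where
  "avg K \<sigma> \<tau> f x = (\<Sum>y \<in> succs K \<sigma> \<tau> x. kern K x y * f y)"

lemma avg_max: "x \<in> maxv K \<Longrightarrow> avg K \<sigma> \<tau> f x = f (\<sigma> x)"
  by (simp add: avg_def succs_def kern_def)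

lemma avg_min: "x \<in> minv K \<Longrightarrow> x \<notin> maxv K \<Longrightarrow> avg K \<sigma> \<tau> f x = f (\<tau> x)"
  by (simp add: avg_def succs_def kern_def)

lemma nsteps_Suc_avg:
  "nsteps K \<sigma> \<tau> (Suc n) x = (if x \<in> sinks K then sval K x else avg K \<sigma> \<tau> (nsteps K \<sigma> \<tau> n) x)"
  by (simp add: avg_def succs_def kern_def)

declare nsteps.simps(2) [simp del]

lemma nsteps_sink: "x \<in> sinks K \<Longrightarrow> nsteps K \<sigma> \<tau> n x = sval K x"
  by (cases n) (auto simp: nsteps_Suc_avg)

lemma val_sink: "x \<in> sinks K \<Longrightarrow> val K \<sigma> \<tau> x = sval K x"
  by (simp add: val_def nsteps_sink)

text \<open>Lets a MIN strategy of a transformed game be replaced by a lifted one that agrees with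
  it on MIN vertices only.\<close>

lemma val_cong_min:
  assumes "\<And>x. x \<in> minv K \<Longrightarrow> \<tau> x = \<tau>' x"
  shows "val K \<sigma> \<tau> = val K \<sigma> \<tau>'"
proof -
  have "nsteps K \<sigma> \<tau> n x = nsteps K \<sigma> \<tau>' n x" for n x
    by (induction n arbitrary: x) (auto simp: nsteps.simps(2) assms)
  then show ?thesis by (simp add: val_def fun_eq_iff)
qed

text \<open>Weaker than being an SSG: the sink values of a transformed game are not required to be
  rational.\<close>
locale game =
  fixes K :: "('v, 'z) ssg_scheme"
  assumes finite_verts: "finite (verts K)"
    and verts_eq: "verts K = maxv K \<union> minv K \<union> randv K \<union> sinks K"
    and disj: "maxv K \<inter> minv K = {}" "maxv K \<inter> sinks K = {}" "minv K \<inter> sinks K = {}"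
      "maxv K \<inter> randv K = {}" "minv K \<inter> randv K = {}" "randv K \<inter> sinks K = {}"
    and arcs_verts: "arcs K \<subseteq> verts K \<times> verts K"
    and outn_min: "x \<in> minv K \<Longrightarrow> outn K x \<noteq> {}"
    and prob_pos: "x \<in> randv K \<Longrightarrow> y \<in> outn K x \<Longrightarrow> prob K x y > 0"
    and prob_sum: "x \<in> randv K \<Longrightarrow> (\<Sum>y \<in> outn K x. prob K x y) = 1"
    and sval_bounds: "s \<in> sinks K \<Longrightarrow> 0 \<le> sval K s \<and> sval K s \<le> 1"
begin

lemma outn_verts: "outn K x \<subseteq> verts K"
  using arcs_verts by (auto simp: outn_def)

lemma finite_outn: "finite (outn K x)"
  using outn_verts finite_verts finite_subset by metis

lemma vert_cases:
  assumes "x \<in> verts K - sinks K"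
  obtains "x \<in> maxv K" "x \<notin> minv K" "x \<notin> randv K" | "x \<in> minv K" "x \<notin> maxv K" "x \<notin> randv K"
    | "x \<in> randv K" "x \<notin> maxv K" "x \<notin> minv K"
  using assms verts_eq disj by blast

context
  fixes \<sigma> \<tau> assumes strats: "max_strat K \<sigma>" "min_strat K \<tau>"
begin

lemma succs_verts: "x \<in> verts K - sinks K \<Longrightarrow> succs K \<sigma> \<tau> x \<subseteq> verts K"
  using strats arcs_verts outn_verts
  by (auto simp: succs_def max_strat_def min_strat_def)

lemma finite_succs: "finite (succs K \<sigma> \<tau> x)"
  by (simp add: succs_def finite_outn)

lemma kern_pos: "x \<in> verts K - sinks K \<Longrightarrow> y \<in> succs K \<sigma> \<tau> x \<Longrightarrow> kern K x y > 0"
  by (erule vert_cases) (auto simp: succs_def kern_def prob_pos)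

lemma kern_sum: "x \<in> verts K - sinks K \<Longrightarrow> sum (kern K x) (succs K \<sigma> \<tau> x) = 1"
  by (erule vert_cases) (auto simp: succs_def kern_def prob_sum)

lemma avg_mono:
  assumes "x \<in> verts K - sinks K" "\<And>y. y \<in> verts K \<Longrightarrow> f y \<le> g y"
  shows "avg K \<sigma> \<tau> f x \<le> avg K \<sigma> \<tau> g x"
  unfolding avg_def using assms succs_verts kern_pos
  by (intro sum_mono mult_left_mono) (blast intro: less_imp_le)+

lemma nsteps_nonneg: "x \<in> verts K \<Longrightarrow> 0 \<le> nsteps K \<sigma> \<tau> n x"
proof (induction n arbitrary: x)
  case (Suc n)
  have "0 \<le> avg K \<sigma> \<tau> (nsteps K \<sigma> \<tau> n) x" if "x \<notin> sinks K"
    using avg_mono[of x "\<lambda>_. 0" "nsteps K \<sigma> \<tau> n"] Suc that by (simp add: avg_def)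
  then show ?case using sval_bounds by (simp add: nsteps_Suc_avg)
qed (use sval_bounds in auto)

lemma nsteps_le_superharmonic:
  assumes "\<And>x. x \<in> verts K - sinks K \<Longrightarrow> avg K \<sigma> \<tau> f x \<le> f x"
    and "\<And>s. s \<in> sinks K \<Longrightarrow> sval K s \<le> f s"
    and "\<And>x. x \<in> verts K \<Longrightarrow> 0 \<le> f x"
  shows "x \<in> verts K \<Longrightarrow> nsteps K \<sigma> \<tau> n x \<le> f x"
proof (induction n arbitrary: x)
  case (Suc n)
  have "avg K \<sigma> \<tau> (nsteps K \<sigma> \<tau> n) x \<le> f x" if "x \<notin> sinks K"
    using avg_mono[of x "nsteps K \<sigma> \<tau> n" f] Suc that assms(1)[of x] by fastforce
  then show ?case using assms(2) by (simp add: nsteps_Suc_avg)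
qed (use assms in auto)

lemma nsteps_le_1: "x \<in> verts K \<Longrightarrow> nsteps K \<sigma> \<tau> n x \<le> 1"
  by (rule nsteps_le_superharmonic) (auto simp: avg_def kern_sum sval_bounds)

lemma nsteps_mono_Suc: "x \<in> verts K \<Longrightarrow> nsteps K \<sigma> \<tau> n x \<le> nsteps K \<sigma> \<tau> (Suc n) x"
proof (induction n arbitrary: x)
  case 0
  then show ?case
    using nsteps_nonneg[of x "Suc 0"] by (cases "x \<in> sinks K") (auto simp: nsteps_sink)
next
  case (Suc n)
  then show ?case
    using avg_mono[of x "nsteps K \<sigma> \<tau> n" "nsteps K \<sigma> \<tau> (Suc n)"]
    by (simp add: nsteps_Suc_avg[of _ _ _ "Suc n"] nsteps_Suc_avg[of _ _ _ n x])
qed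

lemma bdd_nsteps: "x \<in> verts K \<Longrightarrow> bdd_above (range (\<lambda>n. nsteps K \<sigma> \<tau> n x))"
  by (rule bdd_aboveI[of _ 1]) (auto simp: nsteps_le_1)

lemma nsteps_tendsto: "x \<in> verts K \<Longrightarrow> (\<lambda>n. nsteps K \<sigma> \<tau> n x) \<longlonglongrightarrow> val K \<sigma> \<tau> x"
  unfolding val_def
  by (rule LIMSEQ_incseq_SUP[OF bdd_nsteps]) (auto intro: incseq_SucI nsteps_mono_Suc)

lemma nsteps_le_val: "x \<in> verts K \<Longrightarrow> nsteps K \<sigma> \<tau> n x \<le> val K \<sigma> \<tau> x"
  unfolding val_def by (rule cSUP_upper[OF _ bdd_nsteps]) auto

lemma val_nonneg: "x \<in> verts K \<Longrightarrow> 0 \<le> val K \<sigma> \<tau> x"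
  using nsteps_nonneg nsteps_le_val order_trans by blast

text \<open>The value is the least nonnegative superharmonic function above the sink payoffs.
  Nonnegativity accounts for unfinished plays, which pay 0.\<close>

lemma val_le_superharmonic:
  assumes "\<And>x. x \<in> verts K - sinks K \<Longrightarrow> avg K \<sigma> \<tau> f x \<le> f x"
    and "\<And>s. s \<in> sinks K \<Longrightarrow> sval K s \<le> f s"
    and "\<And>x. x \<in> verts K \<Longrightarrow> 0 \<le> f x"
    and "x \<in> verts K"
  shows "val K \<sigma> \<tau> x \<le> f x"
  unfolding val_def using nsteps_le_superharmonic[OF assms(1-3)] assms(4) by (intro cSUP_least) auto

lemma val_le_1: "x \<in> verts K \<Longrightarrow> val K \<sigma> \<tau> x \<le> 1"
  unfolding val_def using nsteps_le_1 by (intro cSUP_least) auto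

lemma val_avg:
  assumes "x \<in> verts K - sinks K"
  shows "val K \<sigma> \<tau> x = avg K \<sigma> \<tau> (val K \<sigma> \<tau>) x"
proof (rule LIMSEQ_unique)
  show "(\<lambda>n. nsteps K \<sigma> \<tau> (Suc n) x) \<longlonglongrightarrow> val K \<sigma> \<tau> x"
    using nsteps_tendsto assms by (intro LIMSEQ_Suc) auto
  show "(\<lambda>n. nsteps K \<sigma> \<tau> (Suc n) x) \<longlonglongrightarrow> avg K \<sigma> \<tau> (val K \<sigma> \<tau>) x"
    using assms succs_verts[OF assms] nsteps_tendsto
    by (auto simp: nsteps_Suc_avg avg_def intro!: tendsto_sum tendsto_mult tendsto_const)
qed

text \<open>The play stays in \<open>M\<close> forever and meets no sink.\<close>

lemma val_zero_on_closed:
  assumes "M \<subseteq> verts K - sinks K" "\<And>x. x \<in> M \<Longrightarrow> succs K \<sigma> \<tau> x \<subseteq> M" "x \<in> M"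
  shows "val K \<sigma> \<tau> x = 0"
proof -
  have "nsteps K \<sigma> \<tau> n x = 0" if "x \<in> M" for n x
    using that
  proof (induction n arbitrary: x)
    case (Suc n)
    then have "nsteps K \<sigma> \<tau> n y = 0" if "y \<in> succs K \<sigma> \<tau> x" for y
      using that assms(2) by blast
    moreover have "x \<notin> sinks K" using Suc.prems assms(1) by auto
    ultimately show ?case by (simp add: nsteps_Suc_avg avg_def)
  qed (use assms(1) in auto)
  then show ?thesis using assms(3) by (simp add: val_def)
qed

text \<open>Maximum principle: the points where \<open>f\<close> exceeds the value by the largest amount form a
  closed set without sinks, on which the value vanishes.\<close>
lemma subharmonic_le_val_or_closed:
  assumes sub: "\<And>x. x \<in> verts K - sinks K \<Longrightarrow> f x \<le> avg K \<sigma> \<tau> f x"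
    and sink: "\<And>s. s \<in> sinks K \<Longrightarrow> f s \<le> sval K s"
  obtains (le) "\<And>x. x \<in> verts K \<Longrightarrow> f x \<le> val K \<sigma> \<tau> x"
  | (closed) M c where "M \<noteq> {}" "M \<subseteq> verts K - sinks K" "\<And>x. x \<in> M \<Longrightarrow> succs K \<sigma> \<tau> x \<subseteq> M"
      "c > 0" "\<And>x. x \<in> M \<Longrightarrow> f x = c"
proof (cases "\<forall>x \<in> verts K. f x \<le> val K \<sigma> \<tau> x")
  case True
  then show thesis using le by blast
next
  case False
  define d where "d x = f x - val K \<sigma> \<tau> x" for x
  define c where "c = Max (d ` verts K)"
  define M where "M = {x \<in> verts K. d x = c}"
  obtain z where z: "z \<in> verts K" "d z > 0" using False by (auto simp: d_def not_le)
  have le_c: "d x \<le> c" if "x \<in> verts K" for x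
    using that finite_verts by (simp add: c_def)
  have c: "c > 0" using le_c[OF z(1)] z(2) by simp
  have "c \<in> d ` verts K"
    unfolding c_def using finite_verts z(1) by (intro Max_in) auto
  then have ne: "M \<noteq> {}" by (auto simp: M_def)
  have "d s \<le> 0" if "s \<in> sinks K" for s
    using sink[OF that] by (simp add: d_def val_sink[OF that])
  then have sinkless: "M \<subseteq> verts K - sinks K"
    using c by (fastforce simp: M_def)
  have closed_M: "succs K \<sigma> \<tau> x \<subseteq> M" if "x \<in> M" for x
  proof
    fix y assume y: "y \<in> succs K \<sigma> \<tau> x"
    have x: "x \<in> verts K - sinks K" using sinkless that by auto
    \<comment> \<open>The value is harmonic, so \<open>d\<close> inherits subharmonicity from
      \<open>f\<close>, and a maximal \<open>d x\<close> forces the same \<open>d\<close> at all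
      successors.\<close>
    have "avg K \<sigma> \<tau> d x = avg K \<sigma> \<tau> f x - avg K \<sigma> \<tau> (val K \<sigma> \<tau>) x"
      by (simp add: avg_def d_def right_diff_distrib sum_subtractf)
    then have "d x \<le> avg K \<sigma> \<tau> d x"
      using sub[OF x] val_avg[OF x] by (simp add: d_def)
    then have "c \<le> (\<Sum>y \<in> succs K \<sigma> \<tau> x. kern K x y * d y)"
      using that by (simp add: M_def avg_def)
    then have "d y = c"
      using convex_sum_eq_bound[OF finite_succs kern_pos[OF x] kern_sum[OF x] _ _ y] le_c
        succs_verts[OF x] by blast
    then show "y \<in> M" using succs_verts[OF x] y by (auto simp: M_def)
  qed
  have "f x = c" if "x \<in> M" for x
    using that val_zero_on_closed[OF sinkless closed_M that] by (simp add: M_def d_def)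
  then show thesis using closed ne sinkless closed_M c by blast
qed

end

section \<open>Best responses\<close>

lemma min_strat_ex: "\<exists>\<tau>. min_strat K \<tau>"
proof -
  have "\<forall>x. \<exists>y. x \<in> minv K \<longrightarrow> (x, y) \<in> arcs K"
    using outn_min by (auto simp: outn_def)
  then show ?thesis unfolding min_strat_def by metis
qed

context
  fixes \<sigma> assumes \<sigma>: "max_strat K \<sigma>"
begin

text \<open>A strategy greedy for the pointwise infimum \<open>v\<close> of all values makes \<open>v\<close> superharmonic, so
  its value is at most \<open>v\<close>.\<close>
lemma best_resp_ex: "\<exists>\<tau>. best_resp K \<sigma> \<tau>"
proof -
  define T where "T = {\<tau>. min_strat K \<tau>}"
  define v where "v x = (INF \<tau> \<in> T. val K \<sigma> \<tau> x)" for x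
  have ne: "T \<noteq> {}" using min_strat_ex by (simp add: T_def)
  have v_le: "v x \<le> val K \<sigma> \<tau> x" if "\<tau> \<in> T" "x \<in> verts K" for \<tau> x
    unfolding v_def using that val_nonneg[OF \<sigma>]
    by (intro cINF_lower) (auto simp: T_def intro!: bdd_belowI[of _ 0])
  have v_ge: "a \<le> v x" if "\<And>\<tau>. \<tau> \<in> T \<Longrightarrow> a \<le> val K \<sigma> \<tau> x" for a x
    unfolding v_def using that ne by (intro cINF_greatest) auto
  have "\<forall>x. \<exists>y. x \<in> minv K \<longrightarrow> y \<in> outn K x \<and> (\<forall>z \<in> outn K x. v y \<le> v z)"
    using arg_min_if_finite[OF finite_outn outn_min] by (metis linorder_not_less)
  then obtain \<tau> where \<tau>: "\<And>x. x \<in> minv K \<Longrightarrow> \<tau> x \<in> outn K x"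
    "\<And>x z. x \<in> minv K \<Longrightarrow> z \<in> outn K x \<Longrightarrow> v (\<tau> x) \<le> v z" by metis
  have \<tau>T: "min_strat K \<tau>" using \<tau>(1) by (auto simp: min_strat_def outn_def)
  have "avg K \<sigma> \<tau> v x \<le> v x" if x: "x \<in> verts K - sinks K" for x
  \<comment> \<open>As \<open>v\<close> is an infimum, it suffices to compare with each
    \<open>\<tau>'\<close>: the greedy move is at least as good for \<open>v\<close>, and
    \<open>v\<close> is below the value of \<open>\<tau>'\<close>.\<close>
  proof (rule v_ge)
    fix \<tau>' assume "\<tau>' \<in> T"
    then have \<tau>': "min_strat K \<tau>'" by (simp add: T_def)
    have "avg K \<sigma> \<tau> v x \<le> avg K \<sigma> \<tau>' v x"
      using x
    proof (cases rule: vert_cases)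
      case 2
      then show ?thesis
        using \<tau>(2)[of x "\<tau>' x"] \<tau>' by (simp add: avg_min min_strat_def outn_def)
    qed (auto simp: avg_def succs_def)
    also have "\<dots> \<le> avg K \<sigma> \<tau>' (val K \<sigma> \<tau>') x"
      using v_le \<open>\<tau>' \<in> T\<close> by (intro avg_mono[OF \<sigma> \<tau>' x]) auto
    finally show "avg K \<sigma> \<tau> v x \<le> val K \<sigma> \<tau>' x"
      using val_avg[OF \<sigma> \<tau>' x] by simp
  qed
  then have le_v: "val K \<sigma> \<tau> x \<le> v x" if "x \<in> verts K" for x
    using that sval_bounds val_nonneg[OF \<sigma>]
    by (intro val_le_superharmonic[OF \<sigma> \<tau>T]) (auto intro!: v_ge simp: val_sink T_def)
  have "best_resp K \<sigma> \<tau>"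
    unfolding best_resp_def T_def
    using \<tau>T order_trans[OF le_v v_le[unfolded T_def]] by blast
  then show ?thesis by blast
qed

lemma best_resp_br: "best_resp K \<sigma> (br K \<sigma>)"
  unfolding br_def using best_resp_ex by (rule someI_ex)

lemma min_strat_br: "min_strat K (br K \<sigma>)"
  using best_resp_br by (simp add: best_resp_def)

lemma val_s_le_val: "min_strat K \<tau> \<Longrightarrow> x \<in> verts K \<Longrightarrow> val_s K \<sigma> x \<le> val K \<sigma> \<tau> x"
  using best_resp_br by (simp add: best_resp_def val_s_def)

lemma val_s_nonneg: "x \<in> verts K \<Longrightarrow> 0 \<le> val_s K \<sigma> x"
  unfolding val_s_def by (rule val_nonneg[OF \<sigma> min_strat_br])

lemma val_s_le_1: "x \<in> verts K \<Longrightarrow> val_s K \<sigma> x \<le> 1"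
  unfolding val_s_def by (rule val_le_1[OF \<sigma> min_strat_br])

lemma val_s_sink: "x \<in> sinks K \<Longrightarrow> val_s K \<sigma> x = sval K x"
  unfolding val_s_def by (rule val_sink)

lemma val_s_avg_br: "x \<in> verts K - sinks K \<Longrightarrow> val_s K \<sigma> x = avg K \<sigma> (br K \<sigma>) (val_s K \<sigma>) x"
  unfolding val_s_def by (rule val_avg[OF \<sigma> min_strat_br])

lemma val_s_max: "x \<in> maxv K \<Longrightarrow> val_s K \<sigma> x = val_s K \<sigma> (\<sigma> x)"
  using val_s_avg_br[of x] disj verts_eq by (auto simp: avg_max)

text \<open>Switching a best response at \<open>x\<close> to a cheaper \<open>y\<close> keeps
  \<open>val_s\<close> superharmonic, so the switched strategy is a best response too; but under it
  \<open>x\<close> and \<open>y\<close> have equal value.\<close>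

lemma val_s_min_le:
  assumes x: "x \<in> minv K" and y: "y \<in> outn K x"
  shows "val_s K \<sigma> x \<le> val_s K \<sigma> y"
proof (rule ccontr)
  assume less: "\<not> ?thesis"
  define \<tau> where "\<tau> = (br K \<sigma>)(x := y)"
  have \<tau>: "min_strat K \<tau>"
    using min_strat_br y by (simp add: \<tau>_def min_strat_def outn_def)
  have xV: "x \<in> verts K - sinks K" using x disj verts_eq by auto
  have xmax: "x \<notin> maxv K" using x disj by auto
  have yV: "y \<in> verts K" using y outn_verts by auto
  have "avg K \<sigma> \<tau> (val_s K \<sigma>) z \<le> val_s K \<sigma> z" if z: "z \<in> verts K - sinks K" for z
  proof (cases "z = x")
    case True
    then show ?thesis using x xmax less by (simp add: avg_min \<tau>_def)
  next
    case False
    then have "avg K \<sigma> \<tau> (val_s K \<sigma>) z = avg K \<sigma> (br K \<sigma>) (val_s K \<sigma>) z"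
      by (simp add: avg_def succs_def \<tau>_def)
    then show ?thesis using val_s_avg_br[OF z] by linarith
  qed
  then have "val K \<sigma> \<tau> z \<le> val_s K \<sigma> z" if "z \<in> verts K" for z
    using that val_s_nonneg by (intro val_le_superharmonic[OF \<sigma> \<tau>]) (auto simp: val_s_sink)
  then have eq: "val K \<sigma> \<tau> z = val_s K \<sigma> z" if "z \<in> verts K" for z
    using val_s_le_val[OF \<tau>] that by (meson antisym)
  have "val K \<sigma> \<tau> x = val K \<sigma> \<tau> y"
    using val_avg[OF \<sigma> \<tau> xV] x xmax by (simp add: avg_min \<tau>_def)
  then show False using eq[of x] eq[of y] xV yV less by simp
qed

text \<open>Any MIN reply can only raise the one-step average: at MIN vertices by
  \<open>val_s_min_le\<close>, while elsewhere the reply does not matter.\<close>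

lemma val_s_subharmonic:
  assumes "min_strat K \<tau>" "x \<in> verts K - sinks K"
  shows "val_s K \<sigma> x \<le> avg K \<sigma> \<tau> (val_s K \<sigma>) x"
  using assms(2)
proof (cases rule: vert_cases)
  case 2
  then show ?thesis using val_s_min_le[of x "\<tau> x"] assms(1) by (simp add: avg_min min_strat_def outn_def)
qed (subst val_s_avg_br[OF assms(2)], simp add: avg_def succs_def)+

end

end

lemma game_if_is_ssg: "is_ssg G \<Longrightarrow> game G"
  unfolding is_ssg_def by unfold_locales auto

section \<open>Transformed games\<close>

text \<open>The head in the transformed game of the arc from \<open>x\<close> to \<open>y\<close>,
  which treats kept and redirected arcs uniformly.\<close>

definition tgt :: "'v ssg \<Rightarrow> ('v \<times> 'v) set \<Rightarrow> 'v \<Rightarrow> 'v \<Rightarrow> 'v + 'v \<times> 'v" where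
  "tgt G A x y = (if (x, y) \<in> redir G A then Inr (x, y) else Inl y)"

lemma lift_Inl: "lift G A \<sigma> (Inl x) = tgt G A x (\<sigma> x)"
  by (simp add: lift_def tgt_def)

lemma inj_tgt: "inj_on (tgt G A x) N"
  by (auto simp: inj_on_def tgt_def)

lemma outn_transform: "outn (transform G A \<sigma>) (Inl x) = tgt G A x ` outn G x"
  by (auto simp: outn_def transform_def tgt_def redir_def)

lemma prob_transform: "prob (transform G A \<sigma>) (Inl x) (tgt G A x y) = prob G x y"
  by (simp add: transform_def tgt_def)

lemma transform_simps [simp]:
  "verts (transform G A \<sigma>) = Inl ` verts G \<union> Inr ` redir G A"
  "maxv (transform G A \<sigma>) = Inl ` maxv G"
  "minv (transform G A \<sigma>) = Inl ` minv G"
  "randv (transform G A \<sigma>) = Inl ` randv G"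
  "sinks (transform G A \<sigma>) = Inl ` sinks G \<union> Inr ` redir G A"
  "sval (transform G A \<sigma>) (Inl s) = sval G s"
  "sval (transform G A \<sigma>) (Inr e) = val_s G \<sigma> (snd e)"
  by (simp_all add: transform_def)

lemma nonsink_transform: "verts (transform G A \<sigma>) - sinks (transform G A \<sigma>) = Inl ` (verts G - sinks G)"
  by auto

lemma succs_transform:
  "succs (transform G A \<rho>) (lift G A \<sigma>) (lift G A \<tau>) (Inl x) = tgt G A x ` succs G \<sigma> \<tau> x"
  by (auto simp: succs_def lift_Inl outn_transform)

lemma avg_transform:
  "avg (transform G A \<rho>) (lift G A \<sigma>) (lift G A \<tau>) F (Inl x)
     = (\<Sum>y \<in> succs G \<sigma> \<tau> x. kern G x y * F (tgt G A x y))"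
proof -
  have "kern (transform G A \<rho>) (Inl x) (tgt G A x y) = kern G x y" for y
    by (auto simp: kern_def prob_transform)
  then show ?thesis
    unfolding avg_def succs_transform by (simp add: sum.reindex[OF inj_tgt])
qed

lemma arc_transform_iff: "(Inl x, tgt G A x y) \<in> arcs (transform G A \<rho>) \<longleftrightarrow> (x, y) \<in> arcs G"
  by (auto simp: transform_def tgt_def redir_def)

lemma max_strat_lift: "max_strat (transform G A \<rho>) (lift G A \<sigma>) \<longleftrightarrow> max_strat G \<sigma>"
  by (simp add: max_strat_def lift_Inl arc_transform_iff)

lemma min_strat_lift: "min_strat (transform G A \<rho>) (lift G A \<tau>) \<longleftrightarrow> min_strat G \<tau>"
  by (simp add: min_strat_def lift_Inl arc_transform_iff)

text \<open>Allows best responses in the transformed game to be taken among lifted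
  strategies.\<close>

lemma min_strat_transform_lift:
  assumes "min_strat (transform G A \<rho>) \<theta>"
  obtains \<tau> where "min_strat G \<tau>" "\<And>x. x \<in> minv G \<Longrightarrow> \<theta> (Inl x) = lift G A \<tau> (Inl x)"
proof -
  have "\<forall>x. \<exists>y. x \<in> minv G \<longrightarrow> (x, y) \<in> arcs G \<and> \<theta> (Inl x) = tgt G A x y"
    using assms outn_transform[of G A \<rho>] by (fastforce simp: min_strat_def outn_def)
  then obtain \<tau> where "\<And>x. x \<in> minv G \<Longrightarrow> (x, \<tau> x) \<in> arcs G \<and> \<theta> (Inl x) = tgt G A x (\<tau> x)"
    by metis
  then show thesis using that[of \<tau>] by (simp add: min_strat_def lift_Inl)
qed

locale transformed_game = game G for G :: "'v ssg" +
  fixes A :: "('v \<times> 'v) set" and \<sigma> :: "'v \<Rightarrow> 'v"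
  assumes \<sigma>: "max_strat G \<sigma>"
begin

abbreviation "H \<equiv> transform G A \<sigma>"

abbreviation "v \<equiv> val_s G \<sigma>"

lemma redir_verts: "(x, y) \<in> redir G A \<Longrightarrow> y \<in> verts G"
  using arcs_verts by (auto simp: redir_def)

lemma game_transform: "game H"
proof
  have "redir G A \<subseteq> verts G \<times> verts G" using arcs_verts by (auto simp: redir_def)
  then have "finite (redir G A)" using finite_verts by (meson finite_SigmaI finite_subset)
  then show "finite (verts H)" using finite_verts by simp
  show "verts H = maxv H \<union> minv H \<union> randv H \<union> sinks H"
    using verts_eq by auto
  show "maxv H \<inter> minv H = {}" "maxv H \<inter> sinks H = {}" "minv H \<inter> sinks H = {}"
    "maxv H \<inter> randv H = {}" "minv H \<inter> randv H = {}" "randv H \<inter> sinks H = {}"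
    using disj by auto
  show "arcs H \<subseteq> verts H \<times> verts H"
    using arcs_verts by (auto simp: transform_def redir_def)
  show "outn H x \<noteq> {}" if "x \<in> minv H" for x
    using that outn_min by (auto simp: outn_transform)
  show "prob H x y > 0" if "x \<in> randv H" "y \<in> outn H x" for x y
    using that prob_pos by (auto simp: outn_transform prob_transform)
  show "(\<Sum>y \<in> outn H x. prob H x y) = 1" if "x \<in> randv H" for x
    using that prob_sum by (auto simp: outn_transform sum.reindex[OF inj_tgt] prob_transform)
  show "0 \<le> sval H s \<and> sval H s \<le> 1" if "s \<in> sinks H" for s
    using that sval_bounds redir_verts val_s_nonneg[OF \<sigma>] val_s_le_1[OF \<sigma>] by auto
qed

sublocale H: game H by (rule game_transform)

lemma val_s_transform_attained:
  assumes "max_strat G \<sigma>'"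
  obtains \<tau> where "min_strat G \<tau>" "val_s H (lift G A \<sigma>') = val H (lift G A \<sigma>') (lift G A \<tau>)"
proof -
  have "min_strat H (br H (lift G A \<sigma>'))"
    using assms by (intro H.min_strat_br) (simp add: max_strat_lift)
  then obtain \<tau> where "min_strat G \<tau>"
    "\<And>x. x \<in> minv G \<Longrightarrow> br H (lift G A \<sigma>') (Inl x) = lift G A \<tau> (Inl x)"
    by (rule min_strat_transform_lift) blast
  then show thesis
    using that[of \<tau>] val_cong_min[of H "br H (lift G A \<sigma>')" "lift G A \<tau>"]
    unfolding val_s_def by fastforce
qed

text \<open>The old values carried over to \<open>H\<close>; a new sink gets its own payoff, so
  \<open>tgt\<close> does not change the value seen along an arc.\<close>

definition v_ext :: "'v + 'v \<times> 'v \<Rightarrow> real" where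
  "v_ext u = (case u of Inl x \<Rightarrow> v x | Inr e \<Rightarrow> v (snd e))"

lemma v_ext_simps [simp]: "v_ext (Inl x) = v x" "v_ext (Inr e) = v (snd e)" "v_ext (tgt G A x y) = v y"
  by (simp_all add: v_ext_def tgt_def)

lemma avg_v_ext:
  "avg H (lift G A \<sigma>') (lift G A \<tau>) v_ext (Inl x) = avg G \<sigma>' \<tau> v x"
  by (simp add: avg_transform) (simp add: avg_def)

lemma v_ext_sink: "s \<in> sinks H \<Longrightarrow> v_ext s = sval H s"
  using val_s_sink[OF \<sigma>] by auto

lemma v_ext_nonneg: "u \<in> verts H \<Longrightarrow> 0 \<le> v_ext u"
  using val_s_nonneg[OF \<sigma>] redir_verts by auto

text \<open>MIN answers with the old best response; if no MAX move of \<open>\<sigma>'\<close> gains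
  in old values, \<open>v_ext\<close> is superharmonic in \<open>H\<close>.\<close>

lemma val_s_transform_le:
  assumes \<sigma>': "max_strat G \<sigma>'" and le: "\<And>x. x \<in> maxv G \<Longrightarrow> v (\<sigma>' x) \<le> v x" and x: "x \<in> verts G"
  shows "val_s H (lift G A \<sigma>') (Inl x) \<le> v x"
proof -
  have lifts: "max_strat H (lift G A \<sigma>')" "min_strat H (lift G A (br G \<sigma>))"
    using \<sigma>' min_strat_br[OF \<sigma>] by (simp_all add: max_strat_lift min_strat_lift)
  have avg_le: "avg G \<sigma>' (br G \<sigma>) v y \<le> v y" if "y \<in> verts G - sinks G" for y
    using that
  proof (cases rule: vert_cases)
    case 1
    then show ?thesis using le by (simp add: avg_max)
  qed (subst val_s_avg_br[OF \<sigma> that, unfolded avg_def], simp add: avg_def succs_def)+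
  have "val_s H (lift G A \<sigma>') (Inl x) \<le> val H (lift G A \<sigma>') (lift G A (br G \<sigma>)) (Inl x)"
    using x by (intro H.val_s_le_val lifts) simp
  also have "\<dots> \<le> v_ext (Inl x)"
    using x v_ext_nonneg avg_le
    by (intro H.val_le_superharmonic lifts, unfold nonsink_transform) (auto simp: v_ext_sink avg_v_ext)
  finally show ?thesis by simp
qed

text \<open>Replacing heads by sinks of the same value changes nothing: \<open>v_ext\<close> is
  superharmonic for the old best response and subharmonic for every MIN reply.\<close>

lemma val_s_transform_same:
  assumes x: "x \<in> verts G"
  shows "val_s H (lift G A \<sigma>) (Inl x) = v x"
proof (rule antisym)
  show "val_s H (lift G A \<sigma>) (Inl x) \<le> v x"
    using val_s_max[OF \<sigma>] x by (intro val_s_transform_le \<sigma>) auto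
  obtain \<tau> where \<tau>: "min_strat G \<tau>" "val_s H (lift G A \<sigma>) = val H (lift G A \<sigma>) (lift G A \<tau>)"
    using val_s_transform_attained[OF \<sigma>] .
  have lifts: "max_strat H (lift G A \<sigma>)" "min_strat H (lift G A \<tau>)"
    using \<sigma> \<tau> by (simp_all add: max_strat_lift min_strat_lift)
  have sub: "v_ext u \<le> avg H (lift G A \<sigma>) (lift G A \<tau>) v_ext u" if "u \<in> verts H - sinks H" for u
    using that val_s_subharmonic[OF \<sigma> \<tau>(1)] unfolding nonsink_transform by (auto simp: avg_v_ext)
  show "v x \<le> val_s H (lift G A \<sigma>) (Inl x)"
  proof (rule H.subharmonic_le_val_or_closed[OF lifts sub])
    show "v_ext s \<le> sval H s" if "s \<in> sinks H" for s
      using v_ext_sink[OF that] by simp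
    show ?thesis if "\<And>u. u \<in> verts H \<Longrightarrow> v_ext u \<le> val H (lift G A \<sigma>) (lift G A \<tau>) u"
      using that[of "Inl x"] x \<tau>(2) by simp
    show ?thesis if M: "M \<noteq> {}" "M \<subseteq> verts H - sinks H"
      "\<And>u. u \<in> M \<Longrightarrow> succs H (lift G A \<sigma>) (lift G A \<tau>) u \<subseteq> M" "c > 0" "\<And>u. u \<in> M \<Longrightarrow> v_ext u = c"
    for M c
    proof -
      define N where "N = {y. Inl y \<in> M}"
      have NV: "N \<subseteq> verts G - sinks G" using M(2) by (auto simp: N_def)
      \<comment> \<open>As \<open>M\<close> contains no sink, no arc used in \<open>M\<close> is
        redirected, so \<open>M\<close> comes from a closed set of \<open>G\<close>, on which
        \<open>v\<close> cannot be positive.\<close>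
      have "succs G \<sigma> \<tau> y \<subseteq> N" if "y \<in> N" for y
      proof
        fix z assume "z \<in> succs G \<sigma> \<tau> y"
        then have "tgt G A y z \<in> M"
          using M(3)[of "Inl y"] that by (auto simp: succs_transform N_def)
        then show "z \<in> N" using M(2) by (auto simp: N_def tgt_def split: if_splits)
      qed
      then have "val G \<sigma> \<tau> y = 0" if "y \<in> N" for y
        using val_zero_on_closed[OF \<sigma> \<tau>(1) NV _ that] by blast
      moreover obtain y where y: "y \<in> N" using M(1,2) by (fastforce simp: N_def)
      ultimately have "v y \<le> 0"
        using val_s_le_val[OF \<sigma> \<tau>(1), of y] NV by auto
      then show ?thesis using M(4) M(5)[of "Inl y"] y by (simp add: N_def)
    qed
  qed
qed

text \<open>If the maximum principle leaves a closed set \<open>M\<close> on which the transformed value is a constant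
  \<open>c > 0\<close>, then some redirected arc is used in \<open>M\<close>, since otherwise the play never stops there in
  the transformed game either. Its head has old value \<open>c\<close>; on the points of \<open>M\<close> of old value \<open>c\<close>
  both strategies coincide, so these points are closed under the old strategy as well, which
  contradicts \<open>c > 0\<close>.\<close>
lemma val_s_transform_le_val_s:
  assumes \<sigma>': "max_strat G \<sigma>'"
    and ge: "\<And>x. x \<in> verts G \<Longrightarrow> v x \<le> val_s H (lift G A \<sigma>') (Inl x)"
    and same: "\<And>x. x \<in> maxv G \<Longrightarrow> val_s H (lift G A \<sigma>') (Inl x) = v x \<Longrightarrow> \<sigma>' x = \<sigma> x"
    and x: "x \<in> verts G"
  shows "val_s H (lift G A \<sigma>') (Inl x) \<le> val_s G \<sigma>' x"
proof -
  define w where "w = val_s H (lift G A \<sigma>')"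
  define \<tau> where "\<tau> = br G \<sigma>'"
  have \<tau>: "min_strat G \<tau>" unfolding \<tau>_def by (rule min_strat_br[OF \<sigma>'])
  have lifts: "max_strat H (lift G A \<sigma>')" "min_strat H (lift G A \<tau>)"
    using \<sigma>' \<tau> by (simp_all add: max_strat_lift min_strat_lift)
  have w_redir: "w (tgt G A x y) = v y" if "(x, y) \<in> redir G A" for x y
    using that H.val_s_sink[OF lifts(1), of "Inr (x, y)"] by (simp add: w_def tgt_def)
  \<comment> \<open>Undoing a redirection can only help: the sink pays \<open>v y\<close>, which is
    at most \<open>w (Inl y)\<close>. This makes \<open>w\<close> subharmonic in
    \<open>G\<close>.\<close>
  have w_tgt: "w (tgt G A x y) \<le> w (Inl y)" if "y \<in> verts G" for x y
    using ge[OF that] w_redir[of x y] by (cases "(x, y) \<in> redir G A") (auto simp: w_def tgt_def)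
  have w_avg: "w (Inl x) \<le> (\<Sum>y \<in> succs G \<sigma>' \<tau> x. kern G x y * w (tgt G A x y))"
    if "x \<in> verts G - sinks G" for x
    using H.val_s_subharmonic[OF lifts, of "Inl x"] that by (auto simp: avg_transform w_def)
  have sub: "w (Inl x) \<le> avg G \<sigma>' \<tau> (w \<circ> Inl) x" if x: "x \<in> verts G - sinks G" for x
  proof -
    have "(\<Sum>y \<in> succs G \<sigma>' \<tau> x. kern G x y * w (tgt G A x y)) \<le> avg G \<sigma>' \<tau> (w \<circ> Inl) x"
      unfolding avg_def using w_tgt succs_verts[OF \<sigma>' \<tau> x] kern_pos[OF \<sigma>' \<tau> x]
      by (intro sum_mono mult_left_mono) (auto intro: less_imp_le)
    then show ?thesis using w_avg[OF x] by simp
  qed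
  have "w (Inl x) \<le> val_s G \<sigma>' x"
  proof (rule subharmonic_le_val_or_closed[OF \<sigma>' \<tau>, of "w \<circ> Inl"])
    show "(w \<circ> Inl) y \<le> avg G \<sigma>' \<tau> (w \<circ> Inl) y" if "y \<in> verts G - sinks G" for y
      using sub[OF that] by simp
    show "(w \<circ> Inl) s \<le> sval G s" if "s \<in> sinks G" for s
      using H.val_s_sink[OF lifts(1), of "Inl s"] that by (simp add: w_def)
    show ?thesis if "\<And>y. y \<in> verts G \<Longrightarrow> (w \<circ> Inl) y \<le> val G \<sigma>' \<tau> y"
      using that[OF x] by (simp add: val_s_def \<tau>_def)
    show ?thesis if M: "M \<noteq> {}" "M \<subseteq> verts G - sinks G"
      "\<And>y. y \<in> M \<Longrightarrow> succs G \<sigma>' \<tau> y \<subseteq> M" "c > 0" "\<And>y. y \<in> M \<Longrightarrow> (w \<circ> Inl) y = c" for M c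
    proof -
      have w_c: "w (tgt G A y z) = c" if y: "y \<in> M" and z: "z \<in> succs G \<sigma>' \<tau> y" for y z
      proof -
        have yV: "y \<in> verts G - sinks G" using y M(2) by auto
        have "w (tgt G A y z') \<le> c" if "z' \<in> succs G \<sigma>' \<tau> y" for z'
          using w_tgt[of z' y] that M(2) M(3)[OF y] M(5)[of z'] by fastforce
        moreover have "c \<le> (\<Sum>z \<in> succs G \<sigma>' \<tau> y. kern G y z * w (tgt G A y z))"
          using w_avg[OF yV] M(5)[OF y] by simp
        ultimately show ?thesis
          using convex_sum_eq_bound[OF finite_succs[OF \<sigma>' \<tau>] kern_pos[OF \<sigma>' \<tau> yV]
              kern_sum[OF \<sigma>' \<tau> yV], where f = "\<lambda>z. w (tgt G A y z)"] z by blast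
      qed
      define N where "N = {y \<in> M. v y = c}"
      have "N \<noteq> {}"
      proof
        assume "N = {}"
        have unredirected: "(y, z) \<notin> redir G A" if "y \<in> M" "z \<in> succs G \<sigma>' \<tau> y" for y z
        proof
          assume "(y, z) \<in> redir G A"
          then have "v z = c" using w_redir w_c[OF that] by simp
          then have "z \<in> N" using M(3)[OF that(1)] that(2) by (auto simp: N_def)
          with \<open>N = {}\<close> show False by simp
        qed
        obtain y where y: "y \<in> M" using M(1) by auto
        have "val H (lift G A \<sigma>') (lift G A \<tau>) (Inl y) = 0"
        proof (rule H.val_zero_on_closed[OF lifts])
          show "Inl ` M \<subseteq> verts H - sinks H" using M(2) by auto
          show "Inl y \<in> Inl ` M" using y by simp
          show "succs H (lift G A \<sigma>') (lift G A \<tau>) u \<subseteq> Inl ` M" if "u \<in> Inl ` M" for u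
            using that M(3) unredirected by (fastforce simp: succs_transform tgt_def)
        qed
        then have "w (Inl y) \<le> 0"
          using H.val_s_le_val[OF lifts, of "Inl y"] M(2) y by (auto simp: w_def)
        then show False using M(4) M(5)[OF y] by simp
      qed
      then obtain y where y: "y \<in> N" by auto
      have NV: "N \<subseteq> verts G - sinks G" using M(2) by (auto simp: N_def)
      have "succs G \<sigma> \<tau> y \<subseteq> N" if "y \<in> N" for y
      proof
        fix z assume z: "z \<in> succs G \<sigma> \<tau> y"
        have yV: "y \<in> verts G - sinks G" and yM: "y \<in> M" and vy: "v y = c"
          using that NV by (auto simp: N_def)
        \<comment> \<open>On \<open>N\<close> the old value and the transformed value are both
          \<open>c\<close>, so \<open>same\<close> forces the two MAX strategies to agree.\<close>
        have eq: "succs G \<sigma> \<tau> y = succs G \<sigma>' \<tau> y"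
          using same[of y] M(5)[OF yM] vy by (simp add: succs_def w_def)
        then have succsM: "succs G \<sigma> \<tau> y \<subseteq> M" using M(3)[OF yM] by simp
        have "v z' \<le> c" if "z' \<in> succs G \<sigma> \<tau> y" for z'
          using ge[of z'] M(5)[of z'] M(2) succsM that by (fastforce simp: w_def)
        moreover have "c \<le> (\<Sum>z \<in> succs G \<sigma> \<tau> y. kern G y z * v z)"
          using val_s_subharmonic[OF \<sigma> \<tau> yV] vy by (simp add: avg_def)
        ultimately have "v z = c"
          using convex_sum_eq_bound[OF finite_succs[OF \<sigma> \<tau>] kern_pos[OF \<sigma> \<tau> yV] kern_sum[OF \<sigma> \<tau> yV]] z
          by blast
        then show "z \<in> N" using succsM z by (auto simp: N_def)
      qed
      then have "val G \<sigma> \<tau> y = 0"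
        using val_zero_on_closed[OF \<sigma> \<tau> NV _ y] by blast
      then have "v y \<le> 0" using val_s_le_val[OF \<sigma> \<tau>, of y] NV y by auto
      then show ?thesis using M(4) y by (simp add: N_def)
    qed
  qed
  then show ?thesis by (simp add: w_def)
qed

text \<open>The second claim compares old values only, so that the gap can be measured with one
  denominator, that of \<open>v\<close>.\<close>

lemma improves_val_s:
  assumes \<sigma>': "max_strat G \<sigma>'" and imp: "improves G A \<sigma>' \<sigma>"
  shows "\<And>x. x \<in> verts G \<Longrightarrow> v x \<le> val_s G \<sigma>' x"
    and "\<exists>x \<in> maxv G. v x < v (\<sigma>' x)"
proof -
  have ge: "v x \<le> val_s H (lift G A \<sigma>') (Inl x)" if "x \<in> verts G" for x
    using imp that by (simp add: improves_def Let_def val_s_transform_same)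
  have same: "\<sigma>' x = \<sigma> x" if "x \<in> maxv G" "val_s H (lift G A \<sigma>') (Inl x) = v x" for x
    using imp that val_s_transform_same[of x] verts_eq by (simp add: improves_def Let_def)
  show "v x \<le> val_s G \<sigma>' x" if "x \<in> verts G" for x
  proof (rule order_trans[OF ge[OF that]])
    show "val_s H (lift G A \<sigma>') (Inl x) \<le> val_s G \<sigma>' x"
      by (rule val_s_transform_le_val_s[OF \<sigma>' _ _ that]) (fact ge, fact same)
  qed
  show "\<exists>x \<in> maxv G. v x < v (\<sigma>' x)"
  proof (rule ccontr)
    assume "\<not> ?thesis"
    then have "val_s H (lift G A \<sigma>') (Inl x) \<le> v x" if "x \<in> verts G" for x
      using that by (intro val_s_transform_le \<sigma>') (auto simp: not_less)
    then have "val_s H (lift G A \<sigma>') (Inl x) = v x" if "x \<in> verts G" for x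
      using that ge by (meson antisym)
    then show False
      using imp by (auto simp: improves_def Let_def val_s_transform_same)
  qed
qed

end

section \<open>Denominators of values\<close>

lemma val_common_denominator:
  assumes qG: "is_qssg q G" and strats: "max_strat G \<sigma>" "min_strat G \<tau>"
  obtains D :: nat where "D > 0" "D \<le> q ^ card (randv G)"
    "\<And>x. x \<in> verts G \<Longrightarrow> real D * val G \<sigma> \<tau> x \<in> \<int>"
proof -
  interpret game G using qG by (auto simp: is_qssg_def intro: game_if_is_ssg)
  define u where "u = val G \<sigma> \<tau>"
  define V where "V = verts G"
  define S where "S = sinks G"
  have SV: "S \<subseteq> V" using verts_eq by (auto simp: V_def S_def)
  have "0 \<in> sval G ` sinks G" using qG by (simp add: is_qssg_def)
  then obtain s0 where s0: "s0 \<in> S" "sval G s0 = 0" by (auto simp: S_def)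
  have u_nonneg: "0 \<le> u x" if "x \<in> V" for x
    using val_nonneg[OF strats] that by (simp add: u_def V_def)
  have u_s0: "u s0 = 0" using s0 by (simp add: u_def S_def val_sink)
  have "\<forall>x. \<exists>qx. x \<in> randv G \<longrightarrow> 1 \<le> qx \<and> qx \<le> q \<and>
        (\<forall>y. \<exists>l::nat. y \<in> outn G x \<longrightarrow> prob G x y = real l / real qx)"
    using qG by (simp add: is_qssg_def) blast
  then obtain Q where Q: "\<And>x. x \<in> randv G \<Longrightarrow> 1 \<le> Q x \<and> Q x \<le> q \<and>
        (\<forall>y. \<exists>l::nat. y \<in> outn G x \<longrightarrow> prob G x y = real l / real (Q x))"
    by metis
  then obtain L :: "'a \<Rightarrow> 'a \<Rightarrow> nat" where
    L: "\<And>x y. x \<in> randv G \<Longrightarrow> y \<in> outn G x \<Longrightarrow> prob G x y = real (L x y) / real (Q x)"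
    by metis
  \<comment> \<open>\<open>R x\<close> will be the row sum of \<open>l\<close> at \<open>x\<close>:
    1 at deterministic vertices and at those of value 0, which are rerouted.\<close>
  define R where "R x = (if u x \<noteq> 0 \<and> x \<in> randv G then Q x else 1)" for x
  \<comment> \<open>Vertices of value 0 are sent to the 0-sink, which makes the chain absorbing.\<close>
  define l where "l x y = (if u x = 0 then if y = s0 then 1 else 0
      else if y \<in> succs G \<sigma> \<tau> x then if x \<in> randv G then L x y else 1 else 0)" for x y
  have R_pos: "R x > 0" for x using Q[of x] by (auto simp: R_def)
  have l_pos_val: "real (l x y) = (if y \<in> succs G \<sigma> \<tau> x then real (R x) * kern G x y else 0)"
    if x: "x \<in> V - S" "u x \<noteq> 0" for x y
  proof -
    have "x \<in> verts G - sinks G" using x by (simp add: V_def S_def)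
    then show ?thesis
    proof (cases rule: vert_cases)
      case 3
      then show ?thesis
        using x L[of x y] Q[of x] by (auto simp: l_def R_def kern_def succs_def)
    qed (use x in \<open>auto simp: l_def R_def kern_def\<close>)
  qed
  have sum_l: "(\<Sum>y \<in> V. real (l x y) * h y) = real (R x) * (if u x = 0 then h s0 else avg G \<sigma> \<tau> h x)"
    if x: "x \<in> V - S" for x h
  proof (cases "u x = 0")
    case True
    have "(\<Sum>y \<in> V. real (l x y) * h y) = (\<Sum>y \<in> V. if y = s0 then h y else 0)"
      using True by (intro sum.cong) (auto simp: l_def)
    then show ?thesis
      using True s0 SV finite_verts by (auto simp: R_def V_def)
  next
    case False
    have "succs G \<sigma> \<tau> x \<subseteq> V" using succs_verts[OF strats] x by (simp add: V_def S_def)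
    then have "(\<Sum>y \<in> V. real (l x y) * h y) = (\<Sum>y \<in> succs G \<sigma> \<tau> x. real (l x y) * h y)"
      using finite_verts l_pos_val[OF x False] by (intro sum.mono_neutral_right) (auto simp: V_def)
    also have "\<dots> = real (R x) * avg G \<sigma> \<tau> h x"
      using l_pos_val[OF x False] by (simp add: avg_def sum_distrib_left mult.assoc)
    finally show ?thesis using False by simp
  qed
  have total: "(\<Sum>y \<in> V. l x y) = R x" if x: "x \<in> V - S" for x
  proof -
    have "avg G \<sigma> \<tau> (\<lambda>_. 1) x = 1"
      using kern_sum[OF strats] x by (simp add: avg_def V_def S_def)
    then have "real (\<Sum>y \<in> V. l x y) = real (R x)"
      using sum_l[OF x, of "\<lambda>_. 1"] by simp
    then show ?thesis by (simp only: of_nat_eq_iff)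
  qed
  have harm: "real (\<Sum>y \<in> V. l x y) * u x = (\<Sum>y \<in> V. real (l x y) * u y)" if x: "x \<in> V - S" for x
  proof -
    have "u x = avg G \<sigma> \<tau> u x"
      unfolding u_def using x by (intro val_avg[OF strats]) (simp add: V_def S_def)
    then show ?thesis
      unfolding total[OF x] sum_l[OF x] using u_s0 by (cases "u x = 0") simp_all
  qed
  interpret weighted_chain V S l
    using finite_verts SV by unfold_locales (simp_all add: V_def)
  \<comment> \<open>The least horizon with positive expected payoff. From a non-sink of positive
    value some successor has smaller rank; following such successors gives the forest
    \<open>g\<close> of positive weight.\<close>
  define rank where "rank x = (LEAST n. nsteps G \<sigma> \<tau> n x > 0)" for x
  have rank: "nsteps G \<sigma> \<tau> (rank x) x > 0" if "x \<in> V" "u x \<noteq> 0" for x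
  proof -
    have "\<exists>n. nsteps G \<sigma> \<tau> n x > 0"
    proof (rule ccontr)
      assume "\<not> ?thesis"
      then have "u x \<le> 0" unfolding u_def val_def by (intro cSUP_least) (auto simp: not_less)
      then show False using u_nonneg that by force
    qed
    then show ?thesis unfolding rank_def by (rule LeastI_ex)
  qed
  have "\<exists>y \<in> succs G \<sigma> \<tau> x. u y \<noteq> 0 \<and> rank y < rank x" if x: "x \<in> V - S" "u x \<noteq> 0" for x
  proof -
    have xV: "x \<in> verts G - sinks G" using x by (simp add: V_def S_def)
    obtain n where n: "rank x = Suc n"
      using rank[of x] x by (cases "rank x") (auto simp: S_def)
    then have "0 < avg G \<sigma> \<tau> (nsteps G \<sigma> \<tau> n) x"
      using rank[of x] x by (simp add: nsteps_Suc_avg S_def)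
    then obtain y where y: "y \<in> succs G \<sigma> \<tau> x" "nsteps G \<sigma> \<tau> n y > 0"
      unfolding avg_def using kern_pos[OF strats xV]
      by (metis (no_types, lifting) linorder_not_less mult_nonneg_nonpos less_imp_le sum_nonpos)
    have "rank y \<le> n" unfolding rank_def using y(2) by (rule Least_le)
    moreover have "u y > 0"
      using y nsteps_le_val[OF strats, of y n] succs_verts[OF strats xV] by (auto simp: u_def)
    ultimately show ?thesis using y(1) n by (intro bexI[of _ y]) auto
  qed
  then obtain f where f: "\<And>x. x \<in> V - S \<Longrightarrow> u x \<noteq> 0 \<Longrightarrow>
      f x \<in> succs G \<sigma> \<tau> x \<and> u (f x) \<noteq> 0 \<and> rank (f x) < rank x"
    by metis
  define g where "g = restrict (\<lambda>x. if u x = 0 then s0 else f x) (V - S)"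
  have fV: "f x \<in> V" if "x \<in> V - S" "u x \<noteq> 0" for x
    using f[OF that] succs_verts[OF strats, of x] that by (auto simp: V_def S_def)
  have reach: "\<exists>s. leads S g a s" if "a \<in> V" for a
    using that
  proof (induction "rank a" arbitrary: a rule: less_induct)
    case less
    show ?case
    proof (cases "a \<in> S")
      case True
      then show ?thesis by (auto intro: leads.stop)
    next
      case False
      then have a: "a \<in> V - S" using less by simp
      have "\<exists>s. leads S g (g a) s"
      proof (cases "u a = 0")
        case True
        then show ?thesis using a s0 by (auto simp: g_def intro: leads.stop)
      next
        case False
        then show ?thesis using f[OF a] fV[OF a] less.hyps[of "f a"] a by (simp add: g_def)
      qed
      then show ?thesis using False by (auto intro: leads.step)
    qed
  qed
  have gf: "g \<in> forests"
    using reach fV s0 SV by (auto simp: forests_def g_def)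
  have "l x (g x) > 0" if x: "x \<in> V - S" for x
  proof (cases "u x = 0")
    case True
    then show ?thesis using x by (simp add: l_def g_def)
  next
    case False
    have "kern G x (f x) > 0" using kern_pos[OF strats, of x "f x"] f[OF x False] x by (simp add: V_def S_def)
    then have "real (l x (f x)) > 0" using l_pos_val[OF x False] f[OF x False] R_pos by simp
    then show ?thesis using False x by (simp add: g_def)
  qed
  then have wg: "weight g > 0" unfolding weight_def by (intro prod_pos) blast
  have sink: "u s \<in> \<int>" if "s \<in> S" for s
  proof -
    have "sval G s \<in> {0, 1}" using that qG by (auto simp: is_qssg_def S_def)
    then show ?thesis using that by (auto simp: u_def S_def val_sink)
  qed
  obtain D where D: "D > 0" "D \<le> (\<Prod>x \<in> V - S. \<Sum>y \<in> V. l x y)" "\<And>x. x \<in> V \<Longrightarrow> real D * u x \<in> \<int>"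
    using common_denominator[OF gf wg harm sink] by blast
  have "(\<Prod>x \<in> V - S. \<Sum>y \<in> V. l x y) \<le> (\<Prod>x \<in> V - S. if x \<in> randv G then q else 1)"
  proof (rule prod_mono)
    fix x assume "x \<in> V - S"
    then show "0 \<le> (\<Sum>y \<in> V. l x y) \<and> (\<Sum>y \<in> V. l x y) \<le> (if x \<in> randv G then q else 1)"
      using Q[of x] by (auto simp: total R_def)
  qed
  \<comment> \<open>Non-random vertices contribute factors 1.\<close>
  also have "\<dots> = (\<Prod>x \<in> randv G. q)"
    using disj verts_eq finite_verts
    by (intro prod.mono_neutral_cong_right) (auto simp: V_def S_def)
  finally have "D \<le> q ^ card (randv G)" using D(2) by simp
  then show thesis using that D(1,3) by (simp add: u_def V_def)
qed

section \<open>Counting iterations by the sum of the values at MAX vertices\<close>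

lemma common_denominator_gap:
  assumes "real D * a \<in> \<int>" "real D * b \<in> \<int>" "a < b" "0 < D" "D \<le> m"
  shows "a + 1 / real m \<le> b"
proof -
  have "real D * a < real D * b" using assms by simp
  moreover obtain i j where ij: "real D * a = of_int i" "real D * b = of_int j"
    using assms(1,2) by (auto elim!: Ints_cases)
  ultimately have "i + 1 \<le> j" by simp
  then have "real_of_int i + 1 \<le> real_of_int j" by linarith
  then have "real D * a + 1 \<le> real D * b" using ij by simp
  then have "a + 1 / real D \<le> b" using assms(4) by (simp add: field_simps)
  moreover have "1 / real m \<le> 1 / real D" using assms(4,5) by (simp add: frac_le)
  ultimately show ?thesis by simp
qed

theorem theorem26:
  fixes G :: "'v ssg" and q :: nat and \<sigma>s :: "nat \<Rightarrow> 'v \<Rightarrow> 'v" and k :: nat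
  assumes "is_qssg q G"
    and "gsia_run G \<sigma>s k"
  shows "k \<le> card (maxv G) * q ^ card (randv G)"
proof -
  interpret game G using assms(1) by (auto simp: is_qssg_def intro: game_if_is_ssg)
  define m where "m = q ^ card (randv G)"
  define \<Psi> where "\<Psi> i = (\<Sum>x \<in> maxv G. val_s G (\<sigma>s i) x)" for i
  have maxV: "maxv G \<subseteq> verts G" using verts_eq by auto
  have fin: "finite (maxv G)" using maxV finite_verts finite_subset by blast
  have strat: "max_strat G (\<sigma>s i)" if "i \<le> k" for i
    using that assms(2) by (cases i) (auto simp: gsia_run_def Suc_le_eq)
  have step: "\<Psi> i + 1 / real m \<le> \<Psi> (Suc i)" if i: "i < k" for i
  proof -
    have s: "max_strat G (\<sigma>s i)" "max_strat G (\<sigma>s (Suc i))" using i by (auto intro: strat)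
    obtain A where imp: "improves G A (\<sigma>s (Suc i)) (\<sigma>s i)"
      using assms(2) i unfolding gsia_run_def by blast
    interpret transformed_game G A "\<sigma>s i" using s by unfold_locales
    note mono = improves_val_s(1)[OF s(2) imp]
    obtain x where x: "x \<in> maxv G" "val_s G (\<sigma>s i) x < val_s G (\<sigma>s i) (\<sigma>s (Suc i) x)"
      using improves_val_s(2)[OF s(2) imp] by blast
    have yV: "\<sigma>s (Suc i) x \<in> verts G"
      using s(2) x(1) arcs_verts by (auto simp: max_strat_def)
    \<comment> \<open>\<open>D\<close> depends on the iteration; only the bound \<open>m\<close> is
      uniform.\<close>
    obtain D where D: "D > 0" "D \<le> m"
      "\<And>x. x \<in> verts G \<Longrightarrow> real D * val_s G (\<sigma>s i) x \<in> \<int>"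
      using val_common_denominator[OF assms(1) s(1) min_strat_br[OF s(1)]] unfolding val_s_def m_def
      by blast
    have "val_s G (\<sigma>s i) x + 1 / real m \<le> val_s G (\<sigma>s i) (\<sigma>s (Suc i) x)"
      using common_denominator_gap[OF D(3) D(3) x(2) D(1,2)] x(1) maxV yV by auto
    \<comment> \<open>Under the new strategy \<open>x\<close> has the value of the vertex it moves
      to, which has not decreased.\<close>
    also have "\<dots> \<le> val_s G (\<sigma>s (Suc i)) x"
      using mono[OF yV] val_s_max[OF s(2) x(1)] by simp
    finally have "val_s G (\<sigma>s i) x + 1 / real m \<le> val_s G (\<sigma>s (Suc i)) x" .
    moreover have "(\<Sum>y \<in> maxv G - {x}. val_s G (\<sigma>s i) y) \<le> (\<Sum>y \<in> maxv G - {x}. val_s G (\<sigma>s (Suc i)) y)"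
      using mono maxV by (intro sum_mono) auto
    ultimately show ?thesis
      unfolding \<Psi>_def using sum.remove[OF fin x(1)] by (smt (verit))
  qed
  have pot: "real i / real m \<le> \<Psi> i" if "i \<le> k" for i
    using that
  proof (induction i)
    case 0
    have "0 \<le> \<Psi> 0"
      unfolding \<Psi>_def using maxV val_s_nonneg[OF strat] by (intro sum_nonneg) auto
    then show ?case by simp
  next
    case (Suc i)
    then show ?case using step[of i] by (simp add: add_divide_distrib)
  qed
  have "\<Psi> k \<le> (\<Sum>x \<in> maxv G. 1)"
    unfolding \<Psi>_def using maxV val_s_le_1[OF strat] by (intro sum_mono) auto
  then have "real k / real m \<le> real (card (maxv G))" using pot[of k] by simp
  \<comment> \<open>From \<open>0 < D\<close> and \<open>D \<le> m\<close>, which also covers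
    \<open>q = 0\<close> without random vertices.\<close>
  moreover have "m > 0"
    using val_common_denominator[OF assms(1) strat min_strat_br[OF strat]] unfolding m_def
    by (metis le0 less_le_trans)
  ultimately have "real k \<le> real (card (maxv G) * m)"
    by (simp add: field_simps)
  then show ?thesis by (simp only: of_nat_le_iff m_def)
qed

end
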